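(* Let $T$ be a rooted $\mathbb{R}$-special tree. Then its road space $R_T$ is contractible.
   Context: A tree is a partially ordered set $T$ in which the set of predecessors of each point is well ordered; the height of a point is the order type of its set of predecessors, and the $\alpha$-th level is the set of points of height $\alpha$. All trees are assumed Hausdorff, i.e. two points at the same limit level with the same predecessors are equal. A tree is rooted if it has a unique minimal element (the root). A tree $T$ is $\mathbb{R}$-special if there is a strictly increasing (not necessarily continuous) function $T\to\mathbb{R}$. The road space $R_T$ of a tree $T$ is obtained by joining each pair of consecutive points $x<y$ ($y$ an immediate successor of $x$) by a copy $[0,1]_x^y$ of the interval $[0,1]$, with $0$ identified with $x$ and $1$ with $y$; for $A\subset[0,1]$, $A_x^y$ is the corresponding subset of $[0,1]_x^y$. The order of $T$ is extended to $R_T$ in the obvious way, and $T$ is considered as a subset of $R_T$. The topology of $R_T$ is as follows. The interior of each added interval is open and has the usual topology of $(0,1)$. For $x\in T$, let $s(x)$ be the set of immediate successors of $x$, and for $n\ge1$ let $W_{x,n}=\{x\}\cup\bigcup_{y\in s(x)}[0,1/n)_x^y$. If $x$ is a minimal element, a neighborhood basis of $x$ is $\{W_{x,n}:n\ge 1\}$. If $x\in s(z)$ with $z\in T$, a neighborhood basis of $x$ is $\{W_{x,n}\cup(1-1/n,1]_z^x:n\ge 1\}$. If $x\in T$ is at a limit level, a basic neighborhood of $x$ is obtained by choosing $z\in T$ with $z<x$ and $n\ge1$, and taking the union of $\{y\in R_T:z<y<x\}$ with all $W_{w,n}$ for $w\in T$, $z<w\le x$. *)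

theory Defs
  imports "HOL-Analysis.Analysis"
begin

section \<open>Trees\<close>

text \<open>The tree is a set \<open>T\<close> with the order induced from the type; taking \<open>T = UNIV\<close> gives an
  arbitrary partial order.\<close>

definition preds :: "'a::order set \<Rightarrow> 'a \<Rightarrow> 'a set" where
  "preds T x = {y \<in> T. y < x}"

text \<open>The height of \<open>x\<close> is the order type of this relation: points have the same height iff their
  predecessor orders are related by \<open>ordIso\<close>.\<close>

definition pred_order :: "'a::order set \<Rightarrow> 'a \<Rightarrow> 'a rel" where
  "pred_order T x = {(a, b). a \<in> preds T x \<and> b \<in> preds T x \<and> a \<le> b}"

definition same_level :: "'a::order set \<Rightarrow> 'a \<Rightarrow> 'a \<Rightarrow> bool" where
  "same_level T x y \<longleftrightarrow> (pred_order T x, pred_order T y) \<in> ordIso"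

definition minimal_point :: "'a::order set \<Rightarrow> 'a \<Rightarrow> bool" where
  "minimal_point T x \<longleftrightarrow> x \<in> T \<and> preds T x = {}"

text \<open>The height of \<open>x\<close> is a nonzero limit ordinal. Level \<open>0\<close> is not a limit level.\<close>

definition at_limit_level :: "'a::order set \<Rightarrow> 'a \<Rightarrow> bool" where
  "at_limit_level T x \<longleftrightarrow>
     x \<in> T \<and> preds T x \<noteq> {} \<and> \<not> (\<exists>m\<in>preds T x. \<forall>y\<in>preds T x. y \<le> m)"

definition tree :: "'a::order set \<Rightarrow> bool" where
  "tree T \<longleftrightarrow>
     (\<forall>x\<in>T. well_order_on (preds T x) (pred_order T x)) \<and>
     (\<forall>x y. at_limit_level T x \<and> at_limit_level T y \<and> same_level T x y \<and> preds T x = preds T y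
        \<longrightarrow> x = y)"

definition rooted :: "'a::order set \<Rightarrow> bool" where
  "rooted T \<longleftrightarrow> (\<exists>!r. minimal_point T r)"

definition R_special :: "'a::order set \<Rightarrow> bool" where
  "R_special T \<longleftrightarrow> (\<exists>f :: 'a \<Rightarrow> real. strict_mono_on T f)"

definition succs :: "'a::order set \<Rightarrow> 'a \<Rightarrow> 'a set" where
  "succs T x = {y \<in> T. x < y \<and> \<not> (\<exists>u\<in>T. x < u \<and> u < y)}"

section \<open>Road spaces\<close>

text \<open>\<open>Node x\<close> is the point \<open>x\<close> of the tree; \<open>Inner x y t\<close> with \<open>0 < t < 1\<close> is the interior point
  \<open>t\<close> of the interval joining \<open>x\<close> to its immediate successor \<open>y\<close>.\<close>

datatype 'a road_point = Node 'a | Inner 'a 'a real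

definition edge_point :: "'a \<Rightarrow> 'a \<Rightarrow> real \<Rightarrow> 'a road_point" where
  "edge_point x y t = (if t = 0 then Node x else if t = 1 then Node y else Inner x y t)"

text \<open>\<open>edge_part x y A\<close> is \<open>A\<^sub>x\<^sup>y\<close>, for \<open>A \<subseteq> {0..1}\<close>.\<close>

definition edge_part :: "'a \<Rightarrow> 'a \<Rightarrow> real set \<Rightarrow> 'a road_point set" where
  "edge_part x y A = edge_point x y ` A"

definition road_carrier :: "'a::order set \<Rightarrow> 'a road_point set" where
  "road_carrier T = Node ` T \<union> (\<Union>x\<in>T. \<Union>y\<in>succs T x. edge_part x y {0..1})"

text \<open>The strict order of the road space; it is meaningful on \<open>road_carrier T\<close>.\<close>

fun road_less :: "'a::order road_point \<Rightarrow> 'a road_point \<Rightarrow> bool" where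
  "road_less (Node a) (Node b) \<longleftrightarrow> a < b"
| "road_less (Node a) (Inner x y t) \<longleftrightarrow> a \<le> x"
| "road_less (Inner x y t) (Node b) \<longleftrightarrow> y \<le> b"
| "road_less (Inner x y t) (Inner x' y' t') \<longleftrightarrow> y \<le> x' \<or> (x = x' \<and> y = y' \<and> t < t')"

definition W :: "'a::order set \<Rightarrow> 'a \<Rightarrow> nat \<Rightarrow> 'a road_point set" where
  "W T x n = {Node x} \<union> (\<Union>y\<in>succs T x. edge_part x y {0..<1 / real n})"

fun nhd_basis :: "'a::order set \<Rightarrow> 'a road_point \<Rightarrow> 'a road_point set set" where
  "nhd_basis T (Inner x y t) = {edge_part x y A | A. open A \<and> A \<subseteq> {0<..<1} \<and> t \<in> A}"
| "nhd_basis T (Node x) =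
     {W T x n | n. minimal_point T x \<and> n \<ge> 1}
   \<union> {W T x n \<union> edge_part z x {1 - 1 / real n<..1} | z n. z \<in> T \<and> x \<in> succs T z \<and> n \<ge> 1}
   \<union> {{p \<in> road_carrier T. road_less (Node z) p \<and> road_less p (Node x)}
        \<union> (\<Union>w\<in>{w \<in> T. z < w \<and> w \<le> x}. W T w n)
      | z n. at_limit_level T x \<and> z \<in> T \<and> z < x \<and> n \<ge> 1}"

definition road_open :: "'a::order set \<Rightarrow> 'a road_point set \<Rightarrow> bool" where
  "road_open T U \<longleftrightarrow> U \<subseteq> road_carrier T \<and> (\<forall>p\<in>U. \<exists>N\<in>nhd_basis T p. N \<subseteq> U)"

definition road_space :: "'a::order set \<Rightarrow> 'a road_point topology" where
  "road_space T = topology (road_open T)"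

lemma preds_linear:
  assumes "tree T" "x \<in> T" "a \<in> preds T x" "b \<in> preds T x"
  shows "a \<le> b \<or> b \<le> a"
proof -
  have "total_on (preds T x) (pred_order T x)"
    using assms by (auto simp: tree_def well_order_on_def linear_order_on_def)
  with assms show ?thesis
    unfolding total_on_def pred_order_def by (cases "a = b") auto
qed

lemma edge_part_mono: "A \<subseteq> B \<Longrightarrow> edge_part x y A \<subseteq> edge_part x y B"
  by (auto simp: edge_part_def)

lemma W_mono:
  assumes "1 \<le> m" "m \<le> n"
  shows "W T x n \<subseteq> W T x m"
proof -
  have "{0..<1 / real n} \<subseteq> {0..<1 / real m}"
    using assms by (force simp: frac_le elim: less_le_trans)
  then show ?thesis unfolding W_def edge_part_def by blast
qed

lemma succs_unique_pred:
  assumes "tree T" "x \<in> succs T z" "x \<in> succs T z'" "z \<in> T" "z' \<in> T"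
  shows "z = z'"
  using preds_linear[OF assms(1), of x z z'] assms
  unfolding succs_def preds_def by (force simp: order_less_le)

lemma succs_not_limit:
  assumes "tree T" "x \<in> succs T z" "z \<in> T"
  shows "\<not> at_limit_level T x" "\<not> minimal_point T x"
proof -
  have x: "x \<in> T" "z \<in> preds T x" using assms by (auto simp: succs_def preds_def)
  have "y \<le> z" if "y \<in> preds T x" for y
    using preds_linear[OF assms(1) x(1) that x(2)] that assms(2)
    by (force simp: succs_def preds_def order_less_le)
  with x show "\<not> at_limit_level T x" "\<not> minimal_point T x"
    by (auto simp: at_limit_level_def minimal_point_def)
qed

lemma nhd_basis_minimalI:
  "minimal_point T x \<Longrightarrow> n \<ge> 1 \<Longrightarrow> W T x n \<in> nhd_basis T (Node x)"
  unfolding nhd_basis.simps by blast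

lemma nhd_basis_succI:
  "z \<in> T \<Longrightarrow> x \<in> succs T z \<Longrightarrow> n \<ge> 1 \<Longrightarrow>
     W T x n \<union> edge_part z x {1 - 1 / real n<..1} \<in> nhd_basis T (Node x)"
  unfolding nhd_basis.simps by blast

lemma nhd_basis_limitI:
  "at_limit_level T x \<Longrightarrow> z \<in> T \<Longrightarrow> z < x \<Longrightarrow> n \<ge> 1 \<Longrightarrow>
     {p \<in> road_carrier T. road_less (Node z) p \<and> road_less p (Node x)}
        \<union> (\<Union>w\<in>{w \<in> T. z < w \<and> w \<le> x}. W T w n) \<in> nhd_basis T (Node x)"
  unfolding nhd_basis.simps by blast

lemma nhd_basis_Int:
  assumes T: "tree T" and N: "N1 \<in> nhd_basis T p" "N2 \<in> nhd_basis T p"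
  shows "\<exists>N\<in>nhd_basis T p. N \<subseteq> N1 \<inter> N2"
proof (cases p)
  case (Inner x y t)
  from N obtain A B where AB: "N1 = edge_part x y A" "N2 = edge_part x y B"
    "open A" "open B" "A \<subseteq> {0<..<1}" "B \<subseteq> {0<..<1}" "t \<in> A" "t \<in> B"
    unfolding Inner by auto
  have "edge_part x y (A \<inter> B) \<in> nhd_basis T p"
    using AB unfolding Inner by auto
  moreover have "edge_part x y (A \<inter> B) \<subseteq> N1 \<inter> N2"
    unfolding AB(1,2) by (simp add: edge_part_mono)
  ultimately show ?thesis by blast
next
  case (Node x)
  consider (min) "minimal_point T x" | (suc) z where "z \<in> T" "x \<in> succs T z" | (lim) "at_limit_level T x"
    using N(1) unfolding Node by auto
  then show ?thesis
  proof cases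
    case min
    then have n: "\<not> at_limit_level T x" "\<And>z. z \<in> T \<Longrightarrow> x \<notin> succs T z"
      using succs_not_limit[OF T] by (auto simp: minimal_point_def at_limit_level_def)
    then obtain n1 n2 where h: "N1 = W T x n1" "N2 = W T x n2" "n1 \<ge> 1" "n2 \<ge> 1"
      using N unfolding Node by auto
    then have "W T x (max n1 n2) \<in> nhd_basis T p" unfolding Node using min nhd_basis_minimalI by auto
    then show ?thesis using h W_mono[of n1 "max n1 n2" T x] W_mono[of n2 "max n1 n2" T x] by auto
  next
    case suc
    note nl = succs_not_limit[OF T suc(2,1)]
    define B where "B n = W T x n \<union> edge_part z x {1 - 1 / real n<..1}" for n
    have mono: "B n \<subseteq> B m" if "1 \<le> m" "m \<le> n" for m n
    proof -
      have "1 / real n \<le> 1 / real m" using that by (simp add: frac_le)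
      then have "{1 - 1 / real n<..1} \<subseteq> {1 - 1 / real m<..1}" by auto
      then show ?thesis using W_mono[OF that, of T x] unfolding B_def edge_part_def by blast
    qed
    have ex: "\<exists>n\<ge>1. N = B n" if "N \<in> nhd_basis T p" for N
      using that nl succs_unique_pred[OF T suc(2) _ suc(1)] unfolding Node B_def by auto
    obtain n1 n2 where h: "N1 = B n1" "N2 = B n2" "n1 \<ge> 1" "n2 \<ge> 1"
      using ex N by metis
    have "B (max n1 n2) \<in> nhd_basis T p"
      unfolding Node B_def by (rule nhd_basis_succI) (use suc h in auto)
    then show ?thesis using h mono[of n1 "max n1 n2"] mono[of n2 "max n1 n2"] by auto
  next
    case lim
    then have xT: "x \<in> T" by (simp add: at_limit_level_def)
    have nm: "\<not> minimal_point T x" using lim by (auto simp: at_limit_level_def minimal_point_def)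
    have ns: "x \<notin> succs T z" if "z \<in> T" for z using succs_not_limit[OF T _ that] lim by auto
    define B where "B z n = {p \<in> road_carrier T. road_less (Node z) p \<and> road_less p (Node x)}
        \<union> (\<Union>w\<in>{w \<in> T. z < w \<and> w \<le> x}. W T w n)" for z n
    have ex: "\<exists>z n. N = B z n \<and> z \<in> T \<and> z < x \<and> n \<ge> 1" if "N \<in> nhd_basis T p" for N
      using that nm ns unfolding Node B_def by auto
    obtain z1 n1 where h1: "N1 = B z1 n1" "z1 \<in> T" "z1 < x" "n1 \<ge> 1" using ex N by metis
    obtain z2 n2 where h2: "N2 = B z2 n2" "z2 \<in> T" "z2 < x" "n2 \<ge> 1" using ex N by metis
    have "z1 \<le> z2 \<or> z2 \<le> z1" using preds_linear[OF T xT] h1 h2 by (auto simp: preds_def)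
    then obtain z where z: "z \<in> T" "z < x" "z1 \<le> z" "z2 \<le> z" using h1 h2 by blast
    have less: "road_less (Node z') q" if "z' \<le> z" "road_less (Node z) q" for z' q
      using that by (cases q) auto
    have mono: "B z n \<subseteq> B z' m" if "z' \<le> z" "1 \<le> m" "m \<le> n" for z' m n
    proof -
      have "{p \<in> road_carrier T. road_less (Node z) p \<and> road_less p (Node x)}
          \<subseteq> {p \<in> road_carrier T. road_less (Node z') p \<and> road_less p (Node x)}"
        using less[OF that(1)] by blast
      moreover have "{w \<in> T. z < w \<and> w \<le> x} \<subseteq> {w \<in> T. z' < w \<and> w \<le> x}"
        using that(1) by (auto intro: order.strict_trans1)
      ultimately show ?thesis
        unfolding B_def by (intro Un_mono UN_mono W_mono[OF that(2,3)])
    qed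
    have "B z (max n1 n2) \<in> nhd_basis T p"
    proof -
      have "1 \<le> max n1 n2" using h1 by auto
      then show ?thesis unfolding Node B_def using z lim nhd_basis_limitI by blast
    qed
    then show ?thesis
      using h1 h2 z mono[of z1 n1 "max n1 n2"] mono[of z2 n2 "max n1 n2"] by auto
  qed
qed

lemma istopology_road_open:
  assumes "tree T"
  shows "istopology (road_open T)"
  unfolding istopology_def
proof (intro conjI allI impI)
  fix U V assume UV: "road_open T U" "road_open T V"
  show "road_open T (U \<inter> V)"
    unfolding road_open_def
  proof (intro conjI ballI)
    show "U \<inter> V \<subseteq> road_carrier T" using UV by (auto simp: road_open_def)
    fix p assume "p \<in> U \<inter> V"
    then obtain N1 N2 where "N1 \<in> nhd_basis T p" "N2 \<in> nhd_basis T p" "N1 \<subseteq> U" "N2 \<subseteq> V"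
      using UV unfolding road_open_def by (metis IntE)
    then show "\<exists>N\<in>nhd_basis T p. N \<subseteq> U \<inter> V"
      using nhd_basis_Int[OF assms, of N1 p N2] by blast
  qed
next
  fix K assume K: "\<forall>U\<in>K. road_open T U"
  show "road_open T (\<Union>K)"
    unfolding road_open_def
  proof (intro conjI ballI)
    show "\<Union>K \<subseteq> road_carrier T" using K by (auto simp: road_open_def)
    fix p assume "p \<in> \<Union>K"
    then obtain U where U: "U \<in> K" "p \<in> U" by blast
    then obtain N where "N \<in> nhd_basis T p" "N \<subseteq> U" using K unfolding road_open_def by meson
    then show "\<exists>N\<in>nhd_basis T p. N \<subseteq> \<Union>K" using U by blast
  qed
qed

lemma openin_road_space:
  assumes "tree T"
  shows "openin (road_space T) U \<longleftrightarrow> road_open T U"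
  unfolding road_space_def using istopology_road_open[OF assms] by simp

text \<open>The basic neighborhoods are open sets containing their point, so they do form neighborhood
  bases of the topology.\<close>

lemma mem_edge_part_Inner [simp]:
  "Inner u v t \<in> edge_part x y A \<longleftrightarrow> u = x \<and> v = y \<and> t \<in> A \<and> t \<noteq> 0 \<and> t \<noteq> 1"
  by (auto simp: edge_part_def edge_point_def image_iff)

lemma mem_edge_part_Node [simp]:
  "Node u \<in> edge_part x y A \<longleftrightarrow> (u = x \<and> 0 \<in> A) \<or> (u = y \<and> 1 \<in> A)"
  by (force simp: edge_part_def edge_point_def image_iff)

lemma mem_road_carrier_Node [simp]: "Node u \<in> road_carrier T \<longleftrightarrow> u \<in> T"
  by (auto simp: road_carrier_def succs_def)

lemma mem_road_carrier_Inner [simp]: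
  "Inner x y t \<in> road_carrier T \<longleftrightarrow> x \<in> T \<and> y \<in> succs T x \<and> 0 < t \<and> t < 1"
  by (auto simp: road_carrier_def)

lemma mem_W_Node [simp]: "n \<ge> 1 \<Longrightarrow> Node u \<in> W T x n \<longleftrightarrow> u = x"
  by (auto simp: W_def)

lemma mem_W_Inner [simp]:
  "n \<ge> 1 \<Longrightarrow> Inner u v t \<in> W T x n \<longleftrightarrow> u = x \<and> v \<in> succs T x \<and> 0 < t \<and> t < 1 / real n"
  by (auto simp: W_def)

lemma tree_point_cases:
  assumes "tree T" "x \<in> T"
  obtains "minimal_point T x" | z where "z \<in> T" "x \<in> succs T z" | "at_limit_level T x"
proof (cases "\<exists>m\<in>preds T x. \<forall>y\<in>preds T x. y \<le> m")
  case True
  then obtain m where m: "m \<in> preds T x" "\<And>y. y \<in> preds T x \<Longrightarrow> y \<le> m" by blast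
  then have "x \<in> succs T m" using assms by (fastforce simp: succs_def preds_def)
  then show ?thesis using m that(2) by (auto simp: preds_def)
next
  case False
  then show ?thesis using assms that by (auto simp: minimal_point_def at_limit_level_def)
qed

lemma nhd_basis_mem:
  assumes "p \<in> road_carrier T" "N \<in> nhd_basis T p"
  shows "p \<in> N"
  using assms by (cases p) auto

lemma unit_bounds:
  "t < 1 / real n \<Longrightarrow> Suc 0 \<le> n \<Longrightarrow> t < 1"
  "1 - 1 / real n < t \<Longrightarrow> Suc 0 \<le> n \<Longrightarrow> 0 < t"
proof -
  have "1 / real n \<le> 1" if "Suc 0 \<le> n" using that by simp
  then show "t < 1 / real n \<Longrightarrow> Suc 0 \<le> n \<Longrightarrow> t < 1"
    "1 - 1 / real n < t \<Longrightarrow> Suc 0 \<le> n \<Longrightarrow> 0 < t" by linarith+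
qed

lemma Inner_nhd:
  assumes "a < t" "t < b" "0 \<le> a" "b \<le> 1" "\<And>s. \<lbrakk>a < s; s < b\<rbrakk> \<Longrightarrow> Inner x y s \<in> U"
  shows "\<exists>N\<in>nhd_basis T (Inner x y t). N \<subseteq> U"
proof
  show "edge_part x y {a<..<b} \<in> nhd_basis T (Inner x y t)"
    using assms by auto
  show "edge_part x y {a<..<b} \<subseteq> U"
    using assms by (auto simp: edge_part_def edge_point_def)
qed

lemma W_nhd:
  assumes "Inner u v t \<in> W T x n" "n \<ge> 1" "W T x n \<subseteq> U"
  shows "\<exists>N\<in>nhd_basis T (Inner u v t). N \<subseteq> U"
proof (rule Inner_nhd[of 0 t "1 / real n"])
  have h: "u = x" "v \<in> succs T x" "0 < t" "t < 1 / real n" using assms(1,2) by simp_all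
  then show "0 < t" "t < 1 / real n" by simp_all
  show "1 / real n \<le> 1" using assms(2) by simp
  fix s :: real assume "0 < s" "s < 1 / real n"
  then have "Inner u v s \<in> W T x n" using h assms(2) by simp
  then show "Inner u v s \<in> U" using assms(3) by blast
qed simp

lemma W_subset_carrier:
  assumes "x \<in> T" "n \<ge> 1"
  shows "W T x n \<subseteq> road_carrier T"
proof
  fix p assume "p \<in> W T x n"
  then show "p \<in> road_carrier T"
    using assms by (cases p) (auto dest: unit_bounds)
qed

lemma road_open_nhd_basis:
  assumes T: "tree T" and p: "p \<in> road_carrier T" and N: "N \<in> nhd_basis T p"
  shows "road_open T N"
proof (cases p)
  case (Inner x y t)
  then obtain A where A: "N = edge_part x y A" "open A" "A \<subseteq> {0<..<1}" using N by auto
  show ?thesis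
    unfolding road_open_def
  proof (intro conjI subsetI ballI)
    fix q assume q: "q \<in> N"
    then show "q \<in> road_carrier T" using A p Inner by (cases q) auto
    show "\<exists>N'\<in>nhd_basis T q. N' \<subseteq> N"
      using q A by (cases q) auto
  qed
next
  case (Node x)
  then have xT: "x \<in> T" using p by simp
  from N Node consider (min) n where "N = W T x n" "minimal_point T x" "n \<ge> 1"
    | (suc) z n where "N = W T x n \<union> edge_part z x {1 - 1 / real n<..1}" "z \<in> T" "x \<in> succs T z" "n \<ge> 1"
    | (lim) z n where "N = {p \<in> road_carrier T. road_less (Node z) p \<and> road_less p (Node x)}
        \<union> (\<Union>w\<in>{w \<in> T. z < w \<and> w \<le> x}. W T w n)" "at_limit_level T x" "z \<in> T" "z < x" "n \<ge> 1"
    by auto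
  then show ?thesis
  proof cases
    case min
    show ?thesis
      unfolding road_open_def
    proof (intro conjI ballI)
      show "N \<subseteq> road_carrier T" using min W_subset_carrier xT by blast
      fix q assume q: "q \<in> N"
      show "\<exists>N'\<in>nhd_basis T q. N' \<subseteq> N"
      proof (cases q)
        case (Node w)
        then have "q = p" using q min \<open>p = Node x\<close> by simp
        then show ?thesis using N by blast
      next
        case (Inner u v t)
        then show ?thesis using W_nhd[of u v t T x n N] q min(1,3) by blast
      qed
    qed
  next
    case suc
    show ?thesis
      unfolding road_open_def
    proof (intro conjI ballI)
      have "edge_part z x {1 - 1 / real n<..1} \<subseteq> road_carrier T"
      proof
        fix q assume "q \<in> edge_part z x {1 - 1 / real n<..1}"
        then show "q \<in> road_carrier T" using suc xT by (cases q) (auto dest: unit_bounds)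
      qed
      then show "N \<subseteq> road_carrier T" using suc(1) W_subset_carrier[OF xT suc(4)] by blast
      fix q assume q: "q \<in> N"
      show "\<exists>N'\<in>nhd_basis T q. N' \<subseteq> N"
      proof (cases q)
        case (Node w)
        then have "q = p" using q suc \<open>p = Node x\<close> by (auto dest: unit_bounds)
        then show ?thesis using N by blast
      next
        case (Inner u v t)
        show ?thesis
        proof (cases "q \<in> W T x n")
          case True
          then show ?thesis using Inner W_nhd[of u v t T x n N] suc(1,4) by blast
        next
          case False
          then have h: "u = z" "v = x" "1 - 1 / real n < t" "t \<le> 1" "t \<noteq> 1" using q suc Inner by auto
          show ?thesis
            unfolding Inner h(1,2)
            by (rule Inner_nhd[of "1 - 1 / real n" _ 1]) (use h suc(1,4) in \<open>auto dest: unit_bounds\<close>)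
        qed
      qed
    qed
  next
    case lim
    show ?thesis
      unfolding road_open_def
    proof (intro conjI ballI)
      have "W T w n \<subseteq> road_carrier T" if "w \<in> T" for w using W_subset_carrier that lim(5) by blast
      then show "N \<subseteq> road_carrier T" unfolding lim(1) by blast
      fix q assume q: "q \<in> N"
      have W: "W T w n \<subseteq> N" if "w \<in> T" "z < w" "w \<le> x" for w
        using that unfolding lim(1) by blast
      show "\<exists>N'\<in>nhd_basis T q. N' \<subseteq> N"
      proof (cases q)
        case (Node w)
        then have w: "w \<in> T" "z < w" "w \<le> x" using q lim by auto
        from tree_point_cases[OF T w(1)] show ?thesis
        proof cases
          case 1
          then show ?thesis using w lim(3) by (auto simp: minimal_point_def preds_def)
        next
          case (2 u)
          have "z \<le> u"
            using preds_linear[OF T w(1), of z u] 2 w lim(3)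
            by (force simp: preds_def succs_def order_less_le)
          have "edge_part u w {1 - 1 / real n<..1} \<subseteq> N"
          proof
            fix r assume r: "r \<in> edge_part u w {1 - 1 / real n<..1}"
            show "r \<in> N"
            proof (cases r)
              case (Node v)
              then have "v = w" using r lim(5) by (auto dest: unit_bounds)
              then have "r \<in> W T w n" using Node lim(5) by simp
              then show ?thesis using W[OF w] by blast
            next
              case (Inner a b t)
              then have "r \<in> road_carrier T" "road_less (Node z) r" "road_less r (Node x)"
                using r 2 w \<open>z \<le> u\<close> lim(5) by (auto dest: unit_bounds)
              then show ?thesis unfolding lim(1) by blast
            qed
          qed
          then have "W T w n \<union> edge_part u w {1 - 1 / real n<..1} \<subseteq> N" using W[OF w] by blast
          moreover have "W T w n \<union> edge_part u w {1 - 1 / real n<..1} \<in> nhd_basis T q"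
            unfolding Node by (rule nhd_basis_succI) (use 2 lim(5) in auto)
          ultimately show ?thesis by blast
        next
          case 3
          let ?M = "{p \<in> road_carrier T. road_less (Node z) p \<and> road_less p (Node w)}
            \<union> (\<Union>v\<in>{v \<in> T. z < v \<and> v \<le> w}. W T v n)"
          have less: "road_less r (Node x)" if "road_less r (Node w)" for r
            using that w(3) by (cases r) auto
          have "?M \<subseteq> N" unfolding lim(1) using less w(3) by (blast intro: order_trans)
          moreover have "?M \<in> nhd_basis T q"
            unfolding Node by (rule nhd_basis_limitI) (use 3 w lim(3,5) in auto)
          ultimately show ?thesis by blast
        qed
      next
        case (Inner u v t)
        show ?thesis
        proof (cases "\<exists>w\<in>{w \<in> T. z < w \<and> w \<le> x}. q \<in> W T w n")
          case True
          then obtain w where "w \<in> T" "z < w" "w \<le> x" "Inner u v t \<in> W T w n"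
            using Inner by blast
          then show ?thesis using W_nhd[of u v t T w n N] lim(5) W Inner by blast
        next
          case False
          then have "q \<in> road_carrier T" "road_less (Node z) q" "road_less q (Node x)"
            using q unfolding lim(1) by blast+
          then show ?thesis
            unfolding Inner by (intro Inner_nhd[of 0 _ 1]) (auto simp: lim(1))
        qed
      qed
    qed
  qed
qed

lemma nhd_basis_nonempty:
  assumes "tree T" "p \<in> road_carrier T"
  shows "nhd_basis T p \<noteq> {}"
proof (cases p)
  case (Inner x y t)
  then show ?thesis using assms(2) by (auto intro!: exI[of _ "{0<..<1}"])
next
  case (Node x)
  then have "x \<in> T" using assms(2) by simp
  from tree_point_cases[OF assms(1) this] show ?thesis
  proof cases
    case 1
    then have "W T x 1 \<in> nhd_basis T p" unfolding Node by (rule nhd_basis_minimalI) simp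
    then show ?thesis by blast
  next
    case (2 z)
    then have "W T x 1 \<union> edge_part z x {1 - 1 / real 1<..1} \<in> nhd_basis T p"
      unfolding Node by (rule nhd_basis_succI) simp
    then show ?thesis by blast
  next
    case 3
    then obtain z where "z \<in> T" "z < x" by (auto simp: at_limit_level_def preds_def)
    with 3 have "{p \<in> road_carrier T. road_less (Node z) p \<and> road_less p (Node x)}
        \<union> (\<Union>w\<in>{w \<in> T. z < w \<and> w \<le> x}. W T w 1) \<in> nhd_basis T p"
      unfolding Node by (intro nhd_basis_limitI) auto
    then show ?thesis by blast
  qed
qed

lemma topspace_road_space:
  assumes "tree T"
  shows "topspace (road_space T) = road_carrier T"
proof -
  have "road_open T (road_carrier T)"
    unfolding road_open_def
  proof (intro conjI ballI)
    fix p assume p: "p \<in> road_carrier T"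
    then obtain N where N: "N \<in> nhd_basis T p" using nhd_basis_nonempty[OF assms] by blast
    then have "N \<subseteq> road_carrier T"
      using road_open_nhd_basis[OF assms p] by (simp add: road_open_def)
    with N show "\<exists>N\<in>nhd_basis T p. N \<subseteq> road_carrier T" by blast
  qed simp
  moreover have "U \<subseteq> road_carrier T" if "road_open T U" for U using that by (simp add: road_open_def)
  ultimately show ?thesis
    unfolding topspace_def openin_road_space[OF assms] by blast
qed

end

theory Submission
  imports Defs
begin

text \<open>
  Every point of the road space slides down its own past to the root. If \<open>F\<close> is a strictly
  increasing real function on the road space with value \<open>0\<close> at the root, and if its restriction
  to each chain \<open>{q. q \<le> p}\<close> takes every value between \<open>0\<close> and \<open>F p\<close>, then there is a unique
  \<open>h (t, p) \<le> p\<close> of altitude \<open>min (F p) t\<close>. With \<open>F \<le> 1\<close>, letting \<open>t\<close> run from \<open>0\<close> to \<open>1\<close>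
  leads from the constant map at the root to the identity.

  The map \<open>h\<close> is continuous because \<open>h (t, p)\<close> moves inside a single chain and is located there by
  the number \<open>min (F p) t\<close>. What matters of the topology is that the points strictly above a
  given one form an open set, that small neighborhoods are convex downwards (points below a
  member that are high enough are members), and that a point is a limit of the points of each
  road leaving it. \<open>contractible_space_altitude\<close> derives contractibility from these properties.

  It remains to find \<open>F\<close>. An \<open>\<real>\<close>-special tree has a strictly increasing \<open>f\<close> with values in
  \<open>(0, 1)\<close>, but \<open>f\<close> may jump at limit levels, and then it skips values. Replacing \<open>f x\<close> by the
  supremum of \<open>f\<close> over the successor points up to \<open>x\<close> removes the jumps and keeps strict
  monotonicity (\<open>R_special_altitude\<close>); interpolating linearly along the roads fills the gaps
  between consecutive points, and well-foundedness of the past of a point yields the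
  intermediate value property (\<open>road_altitude_attained\<close>).
\<close>

section \<open>Contracting an ordered space along a real-valued altitude\<close>

text \<open>
  The slide \<open>h\<close> exists by \<open>level\<close> and is unique by \<open>chain\<close> and \<open>mono\<close>. For continuity at
  \<open>(t, p)\<close>, let \<open>N\<close> and \<open>s\<close> be as in \<open>convex\<close> for the point \<open>h (t, p)\<close>. If \<open>F p \<le> t\<close>, then
  \<open>h (t, p) = p\<close>, and for \<open>p'\<close> near \<open>p\<close> and \<open>t'\<close> near \<open>t\<close> the point \<open>h (t', p')\<close> lies below
  \<open>p' \<in> N\<close> at an altitude above \<open>s\<close>, so it is in \<open>N\<close>. If \<open>t < F p\<close>, then \<open>approach\<close> gives a
  point \<open>m \<in> N\<close> strictly between \<open>h (t, p)\<close> and \<open>p\<close>; for all \<open>p'\<close> above \<open>m\<close> and \<open>t'\<close> near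
  \<open>t\<close> the point \<open>h (t', p')\<close> lies on the chain below \<open>m\<close>, again at an altitude above \<open>s\<close>.
\<close>

lemma contractible_space_altitude:
  fixes X :: "'p topology" and lt :: "'p \<Rightarrow> 'p \<Rightarrow> bool" and F :: "'p \<Rightarrow> real"
  assumes trans: "\<And>x y z. \<lbrakk>x \<in> topspace X; y \<in> topspace X; z \<in> topspace X; lt x y; lt y z\<rbrakk> \<Longrightarrow> lt x z"
    and chain: "\<And>x y z. \<lbrakk>x \<in> topspace X; y \<in> topspace X; z \<in> topspace X; lt\<^sup>=\<^sup>= x z; lt\<^sup>=\<^sup>= y z\<rbrakk>
          \<Longrightarrow> lt x y \<or> x = y \<or> lt y x"
    and mono: "\<And>x y. \<lbrakk>x \<in> topspace X; y \<in> topspace X; lt x y\<rbrakk> \<Longrightarrow> F x < F y"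
    and range: "\<And>x. x \<in> topspace X \<Longrightarrow> 0 \<le> F x \<and> F x \<le> 1"
    and bottom: "b \<in> topspace X" "F b = 0" "\<And>x. x \<in> topspace X \<Longrightarrow> lt\<^sup>=\<^sup>= b x"
    and level: "\<And>x s. \<lbrakk>x \<in> topspace X; 0 \<le> s; s \<le> F x\<rbrakk> \<Longrightarrow> \<exists>y\<in>topspace X. lt\<^sup>=\<^sup>= y x \<and> F y = s"
    and above: "\<And>x. x \<in> topspace X \<Longrightarrow> openin X {y \<in> topspace X. lt x y}"
    and convex: "\<And>x U. \<lbrakk>openin X U; x \<in> U\<rbrakk> \<Longrightarrow> \<exists>N s. openin X N \<and> x \<in> N \<and> N \<subseteq> U \<and> s < F x \<and>
          (\<forall>y\<in>N. \<forall>z\<in>topspace X. lt\<^sup>=\<^sup>= z y \<longrightarrow> s < F z \<longrightarrow> z \<in> N)"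
    and approach: "\<And>x y U. \<lbrakk>openin X U; x \<in> U; y \<in> topspace X; lt x y\<rbrakk> \<Longrightarrow> \<exists>z\<in>U. lt x z \<and> lt\<^sup>=\<^sup>= z y"
  shows "contractible_space X"
proof -
  define h where "h = (\<lambda>(t, p). SOME q. q \<in> topspace X \<and> lt\<^sup>=\<^sup>= q p \<and> F q = min (F p) t)"
  have h: "h (t, p) \<in> topspace X \<and> lt\<^sup>=\<^sup>= (h (t, p)) p \<and> F (h (t, p)) = min (F p) t"
    if "p \<in> topspace X" "0 \<le> t" for t p
    unfolding h_def prod.case
    by (rule someI_ex) (use level[of p "min (F p) t"] range that in auto)
  have below: "lt x y" if "x \<in> topspace X" "y \<in> topspace X" "p \<in> topspace X" "lt\<^sup>=\<^sup>= x p" "lt\<^sup>=\<^sup>= y p" "F x < F y" for x y p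
    using chain[OF that(1,2,3,4,5)] mono[OF that(2,1)] that(6) by auto
  have unique: "x = y" if "x \<in> topspace X" "y \<in> topspace X" "p \<in> topspace X" "lt\<^sup>=\<^sup>= x p" "lt\<^sup>=\<^sup>= y p" "F x = F y" for x y p
    using chain[OF that(1,2,3,4,5)] mono[OF that(2,1)] mono[OF that(1,2)] that(6) by auto
  have h_self: "h (t, p) = p" if "p \<in> topspace X" "F p \<le> t" for t p
  proof (rule unique[OF _ that(1) that(1)])
    have "0 \<le> t" using that range by fastforce
    then show "h (t, p) \<in> topspace X" "lt\<^sup>=\<^sup>= (h (t, p)) p" "F (h (t, p)) = F p"
      using h[OF that(1)] that(2) by auto
  qed simp
  have h_bottom: "h (0, p) = b" if "p \<in> topspace X" for p
    using unique[of "h (0, p)" b p] h[OF that, of 0] bottom that range[OF that] by simp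
  let ?P = "prod_topology (top_of_set {0..1}) X"
  have nhd: "\<exists>J V. open J \<and> t \<in> J \<and> openin X V \<and> p \<in> V \<and> (\<forall>t'\<in>J. \<forall>p'\<in>V. 0 \<le> t' \<longrightarrow> h (t', p') \<in> U)"
    if U: "openin X U" "h (t, p) \<in> U" and p: "p \<in> topspace X" and t: "0 \<le> t" for t p U
  proof -
    obtain N s where N: "openin X N" "h (t, p) \<in> N" "N \<subseteq> U" "s < F (h (t, p))"
      and cl: "\<And>y z. \<lbrakk>y \<in> N; z \<in> topspace X; lt\<^sup>=\<^sup>= z y; s < F z\<rbrakk> \<Longrightarrow> z \<in> N"
      using convex[OF U] by meson
    have NX: "N \<subseteq> topspace X" using N(1) by (rule openin_subset)
    show ?thesis
    proof (cases "F p \<le> t")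
      case True
      then have hp: "h (t, p) = p" using h_self p by blast
      \<comment> \<open>Lower semicontinuity of \<open>F\<close>, from the openness of the sets of points above a given one.\<close>
      have "\<exists>V. openin X V \<and> p \<in> V \<and> (\<forall>p'\<in>V. s < F p')"
      proof (cases "s < 0")
        case True
        then show ?thesis using p range by (intro exI[of _ "topspace X"]) force
      next
        case False
        then obtain r where r: "r \<in> topspace X" "lt\<^sup>=\<^sup>= r p" "F r = s"
          using level[OF p, of s] N(4) hp by auto
        then have "lt r p" using N(4) hp by auto
        then show ?thesis
          using above[OF r(1)] p mono[OF r(1)] r(3) by (intro exI[of _ "{y \<in> topspace X. lt r y}"]) auto
      qed
      then obtain V where V: "openin X V" "p \<in> V" "\<And>p'. p' \<in> V \<Longrightarrow> s < F p'" by blast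
      have "h (t', p') \<in> U" if "s < t'" "p' \<in> N \<inter> V" "0 \<le> t'" for t' p'
      proof -
        have "s < F (h (t', p'))" using h[of p' t'] that V(3) NX by auto
        then show ?thesis using cl[of p' "h (t', p')"] h[of p' t'] that NX N(3) by auto
      qed
      then show ?thesis
        using N(1,2,4) V(1,2) hp True
        by (intro exI[of _ "{s<..}"] exI[of _ "N \<inter> V"]) (auto simp: openin_Int)
    next
      case False
      define q where "q = h (t, p)"
      have q: "q \<in> topspace X" "lt\<^sup>=\<^sup>= q p" "F q = t" "q \<in> N" "s < t"
        using h[OF p t] False N(2,4) by (auto simp: q_def)
      then have "lt q p" using False by auto
      obtain r where r: "r \<in> N" "lt q r" "lt\<^sup>=\<^sup>= r p"
        using approach[OF N(1) q(4) p \<open>lt q p\<close>] by blast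
      have rX: "r \<in> topspace X" using r NX by blast
      have "t < F r" using mono[OF q(1) rX r(2)] q(3) by simp
      \<comment> \<open>The point \<open>r\<close> may be \<open>p\<close> itself; one halfway down to \<open>q\<close> is strictly below \<open>p\<close>, so that
        the points above it form a neighborhood of \<open>p\<close>.\<close>
      then obtain m where m: "m \<in> topspace X" "lt\<^sup>=\<^sup>= m r" "F m = (t + F r) / 2"
        using level[OF rX, of "(t + F r) / 2"] t by auto
      have Fm: "t < F m" "F m < F r" using m(3) \<open>t < F r\<close> by auto
      have "lt m r" using m(2) Fm by auto
      then have "lt m p" using r(3) trans[OF m(1) rX p] by auto
      have "m \<in> N" using cl[OF r(1) m(1,2)] Fm q(5) by simp
      have "h (t', p') \<in> U" if "s < t'" "t' < F m" "p' \<in> topspace X" "lt m p'" "0 \<le> t'" for t' p'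
      proof -
        have "F m < F p'" using mono m(1) that by blast
        then have h': "h (t', p') \<in> topspace X" "lt\<^sup>=\<^sup>= (h (t', p')) p'" "F (h (t', p')) = t'"
          using h[OF that(3,5)] that(2) by auto
        then have "lt (h (t', p')) m" using below[OF h'(1) m(1) that(3) h'(2)] that by auto
        then show ?thesis using cl[OF \<open>m \<in> N\<close> h'(1)] h'(3) that(1) N(3) by auto
      qed
      then show ?thesis
        using above[OF m(1)] p \<open>lt m p\<close> q(5) Fm(1)
        by (intro exI[of _ "{s<..<F m}"] exI[of _ "{y \<in> topspace X. lt m y}"]) auto
    qed
  qed
  have "continuous_map ?P X h"
    unfolding continuous_map_def
  proof (intro conjI allI impI)
    show "h \<in> topspace ?P \<rightarrow> topspace X" using h by auto
    fix U assume U: "openin X U"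
    show "openin ?P {x \<in> topspace ?P. h x \<in> U}"
    proof (subst openin_subopen, intro ballI)
      fix x assume "x \<in> {x \<in> topspace ?P. h x \<in> U}"
      then obtain t p where x: "x = (t, p)" "0 \<le> t" "t \<le> 1" "p \<in> topspace X" "h (t, p) \<in> U" by auto
      obtain J V where J: "open J" "t \<in> J" and V: "openin X V" "p \<in> V"
        and JV: "\<And>t' p'. \<lbrakk>t' \<in> J; p' \<in> V; 0 \<le> t'\<rbrakk> \<Longrightarrow> h (t', p') \<in> U"
        using nhd[OF U x(5,4,2)] by meson
      have "openin ?P (({0..1} \<inter> J) \<times> V)"
        using J V(1) by (simp add: openin_prod_Times_iff openin_open_Int)
      moreover have "({0..1} \<inter> J) \<times> V \<subseteq> {x \<in> topspace ?P. h x \<in> U}"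
        using JV openin_subset[OF V(1)] by auto
      ultimately show "\<exists>S. openin ?P S \<and> x \<in> S \<and> S \<subseteq> {x \<in> topspace ?P. h x \<in> U}"
        using x(1-3) J(2) V(2) by (intro exI[of _ "({0..1} \<inter> J) \<times> V"]) simp
    qed
  qed
  then have "homotopic_with (\<lambda>x. True) X X (\<lambda>x. b) id"
    by (subst homotopic_with) (use h_bottom h_self range in \<open>auto intro!: exI[of _ h]\<close>)
  then show ?thesis
    unfolding contractible_space_def by (blast dest: homotopic_with_symD)
qed

section \<open>The order of the road space\<close>

lemma tree_least:
  assumes T: "tree T" and x: "x \<in> T" and w: "w \<in> T" "w \<le> x" "P w"
  obtains m where "m \<in> T" "m \<le> x" "P m" "\<And>v. \<lbrakk>v \<in> T; v < m\<rbrakk> \<Longrightarrow> \<not> P v"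
proof (cases "\<exists>v\<in>preds T x. P v")
  case True
  have wf: "wf (pred_order T x - Id)"
    using T x by (auto simp: tree_def well_order_on_def)
  have "\<exists>m\<in>{v \<in> preds T x. P v}. \<forall>v. (v, m) \<in> pred_order T x - Id \<longrightarrow> v \<notin> {v \<in> preds T x. P v}"
  proof -
    obtain u where "u \<in> {v \<in> preds T x. P v}" using True by blast
    then show ?thesis by (rule wf_eq_minimal[THEN iffD1, OF wf, rule_format])
  qed
  then obtain m where m: "m \<in> preds T x" "P m"
    and least: "\<forall>v. (v, m) \<in> pred_order T x - Id \<longrightarrow> v \<notin> {v \<in> preds T x. P v}"
    by blast
  have "\<not> P v" if "v \<in> T" "v < m" for v
  proof -
    have "v < x" using that m(1) by (auto simp: preds_def)
    then show ?thesis using least[rule_format, of v] m(1) that by (auto simp: pred_order_def preds_def order_less_le)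
  qed
  then show ?thesis using that m by (auto simp: preds_def)
next
  case False
  then have "w = x" using w by (auto simp: preds_def order_less_le)
  then show ?thesis using that[of x] False x w by (auto simp: preds_def)
qed

lemma tree_linear:
  assumes "tree T" "z \<in> T" "x \<in> T" "y \<in> T" "x \<le> z" "y \<le> z"
  shows "x \<le> y \<or> y \<le> x"
  using preds_linear[OF assms(1,2), of x y] assms by (auto simp: preds_def order_less_le)

lemma succs_exists_below:
  assumes "tree T" "a \<in> T" "b \<in> T" "a < b"
  obtains y where "y \<in> succs T a" "y \<le> b"
proof -
  obtain m where "m \<in> T" "m \<le> b" "a < m" "\<And>v. \<lbrakk>v \<in> T; v < m\<rbrakk> \<Longrightarrow> \<not> a < v"
    using tree_least[of T b b "\<lambda>v. a < v"] assms by blast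
  then show ?thesis using that by (auto simp: succs_def)
qed

lemma succs_less: "y \<in> succs T x \<Longrightarrow> y \<in> T \<and> x < y"
  by (auto simp: succs_def)

text \<open>Nothing lies strictly between \<open>x\<close> and its immediate successor \<open>y\<close>; this is what makes a
  point of the road from \<open>x\<close> to \<open>y\<close> comparable with the other points below \<open>c\<close>.\<close>

lemma succs_le_or_le:
  assumes "tree T" "y \<in> succs T x" "x \<in> T" "a \<in> T" "c \<in> T" "a \<le> c" "y \<le> c"
  shows "a \<le> x \<or> y \<le> a"
proof -
  have y: "y \<in> T" "x < y" using assms(2) succs_less by blast+
  then have "a \<le> x \<or> x \<le> a" "a \<le> y \<or> y \<le> a"
    using tree_linear[OF assms(1,5,4)] assms by auto
  then show ?thesis using assms(2,4) by (force simp: succs_def order_less_le)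
qed

lemma road_less_trans:
  assumes "y \<in> road_carrier T" "road_less x y" "road_less y z"
  shows "road_less x z"
  using assms by (cases x; cases y; cases z) (auto dest!: succs_less intro: order.trans less_imp_le
      order.strict_trans order.strict_trans1 order.strict_trans2)

text \<open>Both points lie below a common node \<open>c\<close> of the tree, so that the comparison takes place in
  the chain of tree points up to \<open>c\<close>. There two roads are either equal or one of them ends before
  the other starts: two roads from the same point to different successors cannot both lead
  to \<open>c\<close>.\<close>

lemma road_chain:
  assumes T: "tree T" and p: "p \<in> road_carrier T" and q: "q \<in> road_carrier T" and r: "r \<in> road_carrier T"
    and le: "road_less\<^sup>=\<^sup>= p r" "road_less\<^sup>=\<^sup>= q r"
  shows "road_less p q \<or> p = q \<or> road_less q p"
proof -
  obtain c where c: "c \<in> T" "road_less\<^sup>=\<^sup>= r (Node c)"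
    using r by (cases r) (auto dest: succs_less)
  then have le_c: "road_less\<^sup>=\<^sup>= p (Node c)" "road_less\<^sup>=\<^sup>= q (Node c)"
    using le road_less_trans[OF r] by auto
  have NI: "a \<le> x \<or> y \<le> a" if "Node a \<in> road_carrier T" "road_less\<^sup>=\<^sup>= (Node a) (Node c)"
    "Inner x y t \<in> road_carrier T" "road_less\<^sup>=\<^sup>= (Inner x y t) (Node c)" for a x y t
    using succs_le_or_le[OF T, of y x a c] that c by auto
  show ?thesis
  proof (cases p; cases q)
    fix a a' assume "p = Node a" "q = Node a'"
    then show ?thesis using tree_linear[OF T c(1), of a a'] le_c p q by (auto simp: order_less_le)
  next
    fix a x y t assume "p = Node a" "q = Inner x y t"
    then show ?thesis using NI[of a x y t] le_c p q by auto
  next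
    fix a x y t assume "p = Inner x y t" "q = Node a"
    then show ?thesis using NI[of a x y t] le_c p q by auto
  next
    fix x y t x' y' t' assume pq: "p = Inner x y t" "q = Inner x' y' t'"
    then have s: "x \<in> T" "y \<in> succs T x" "y \<le> c" "x' \<in> T" "y' \<in> succs T x'" "y' \<le> c"
      using le_c p q by auto
    then have "x < c" "x' < c" "y \<in> T" "y' \<in> T"
      by (auto dest!: succs_less intro: order.strict_trans2)
    then have "x' \<le> x \<or> y \<le> x'" "x \<le> x' \<or> y' \<le> x" "x = x' \<Longrightarrow> y \<le> x' \<or> y' \<le> y" "x = x' \<Longrightarrow> y' \<le> x \<or> y \<le> y'"
      using succs_le_or_le[OF T, of y x x' c] succs_le_or_le[OF T, of y' x' x c]
       succs_le_or_le[OF T, of y x y' c] succs_le_or_le[OF T, of y' x' y c] s c by auto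
    then have "y \<le> x' \<or> y' \<le> x \<or> (x = x' \<and> y = y')"
      using s succs_less by (metis leD order_antisym)
    then show ?thesis using pq by auto
  qed
qed


section \<open>An altitude on the road space\<close>

text \<open>The last clause says that \<open>G\<close> does not jump at limit levels: for increasing \<open>G\<close> it means
  that \<open>G x\<close> is the supremum of \<open>G\<close> below \<open>x\<close>.\<close>

definition tree_altitude :: "'a::order set \<Rightarrow> ('a \<Rightarrow> real) \<Rightarrow> bool" where
  "tree_altitude T G \<longleftrightarrow>
     strict_mono_on T G \<and>
     (\<forall>x. 0 \<le> G x \<and> G x \<le> 1) \<and>
     (\<forall>x. minimal_point T x \<longrightarrow> G x = 0) \<and>
     (\<forall>x s. at_limit_level T x \<longrightarrow> (\<forall>w\<in>T. w < x \<longrightarrow> G w \<le> s) \<longrightarrow> G x \<le> s)"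

lemma tree_altitudeD:
  assumes "tree_altitude T G"
  shows "strict_mono_on T G" "0 \<le> G x" "G x \<le> 1" "minimal_point T x \<Longrightarrow> G x = 0"
    "\<lbrakk>at_limit_level T x; \<forall>w\<in>T. w < x \<longrightarrow> G w \<le> s\<rbrakk> \<Longrightarrow> G x \<le> s"
  using assms by (simp_all add: tree_altitude_def)

text \<open>
  Squeeze the given function into \<open>(0, 1)\<close>, call the result \<open>f\<close>, and let \<open>G x\<close> be the supremum of
  \<open>f\<close> over the points up to \<open>x\<close> that are immediate successors, or \<open>0\<close> if there are none. Such
  points are strictly below \<open>x\<close> when \<open>x\<close> is at a limit level, so that \<open>G\<close> does not jump there. It
  remains strictly increasing: for \<open>x < y\<close> some immediate successor \<open>u\<close> of \<open>x\<close> satisfies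
  \<open>u \<le> y\<close>, whence \<open>G x \<le> f x < f u \<le> G y\<close>.
\<close>

lemma R_special_altitude:
  fixes T :: "'a::order set"
  assumes T: "tree T" and special: "R_special T"
  shows "\<exists>G. tree_altitude T G"
proof -
  obtain f0 :: "'a \<Rightarrow> real" where f0: "strict_mono_on T f0" using special by (auto simp: R_special_def)
  define f where "f x = arctan (f0 x) / pi + 1 / 2" for x
  have f_mono: "f x < f y" if "x \<in> T" "y \<in> T" "x < y" for x y
    using strict_mono_onD[OF f0 that] by (simp add: f_def arctan_less_iff divide_strict_right_mono)
  have f01: "0 < f x" "f x < 1" for x
    using arctan_lbound[of "f0 x"] arctan_ubound[of "f0 x"] by (auto simp: f_def field_simps)
  define S where "S x = insert 0 (f ` {y \<in> T. y \<le> x \<and> (\<exists>z\<in>T. y \<in> succs T z)})" for x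
  define G where "G x = Sup (S x)" for x
  have S01: "v \<le> 1" if "v \<in> S x" for v x using that f01 by (auto simp: S_def less_imp_le)
  then have bdd: "bdd_above (S x)" for x by (rule bdd_aboveI)
  have ne: "S x \<noteq> {}" for x by (simp add: S_def)
  have up: "v \<le> G x" if "v \<in> S x" for v x unfolding G_def by (rule cSup_upper[OF that bdd])
  have least: "G x \<le> s" if "\<And>v. v \<in> S x \<Longrightarrow> v \<le> s" for x s
    unfolding G_def by (rule cSup_least[OF ne that])
  have G_le_f: "G x \<le> f x" if "x \<in> T" for x
  proof (rule least)
    fix v assume "v \<in> S x"
    then show "v \<le> f x"
      using f_mono[OF _ that] f01[of x] by (force simp: S_def order_less_le)
  qed
  have f_le_G: "f y \<le> G x" if "z \<in> T" "y \<in> succs T z" "y \<le> x" for x y z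
    by (rule up) (use that succs_less in \<open>force simp: S_def\<close>)
  show ?thesis
    unfolding tree_altitude_def
  proof (intro exI[of _ G] conjI allI impI)
    show "strict_mono_on T G"
    proof (rule strict_mono_onI)
      fix x y assume xy: "x \<in> T" "y \<in> T" "x < y"
      then obtain u where u: "u \<in> succs T x" "u \<le> y" using succs_exists_below[OF T] by blast
      have "G x \<le> f x" using G_le_f xy by blast
      also have "\<dots> < f u" using f_mono xy u succs_less by blast
      also have "\<dots> \<le> G y" using f_le_G xy u by blast
      finally show "G x < G y" .
    qed
    show "0 \<le> G x" "G x \<le> 1" for x
      using up[of 0 x] least[of x 1] S01 by (auto simp: S_def)
    show "G x = 0" if "minimal_point T x" for x
    proof -
      have "\<not> (y \<in> T \<and> y \<le> x \<and> (\<exists>z\<in>T. y \<in> succs T z))" for y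
        using that by (auto simp: minimal_point_def preds_def dest!: succs_less intro: order.strict_trans2)
      then have "S x = {0}" unfolding S_def by blast
      then show ?thesis by (simp add: G_def)
    qed
    show "G x \<le> s" if x: "at_limit_level T x" and s: "\<forall>w\<in>T. w < x \<longrightarrow> G w \<le> s" for x s
    proof (rule least)
      fix v assume "v \<in> S x"
      then consider "v = 0" | y z where "v = f y" "y \<in> T" "y \<le> x" "z \<in> T" "y \<in> succs T z"
        by (auto simp: S_def)
      then show "v \<le> s"
      proof cases
        case 1
        obtain w where "w \<in> T" "w < x" using x by (auto simp: at_limit_level_def preds_def)
        then show ?thesis using s up[of 0 w] 1 by (force simp: S_def)
      next
        case 2
        then have "y < x" using succs_not_limit[OF T] x by (auto simp: order_less_le)
        then show ?thesis using s f_le_G[of z y y] 2 by force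
      qed
    qed
  qed
qed

fun road_altitude :: "('a \<Rightarrow> real) \<Rightarrow> 'a road_point \<Rightarrow> real" where
  "road_altitude G (Node x) = G x"
| "road_altitude G (Inner x y t) = (1 - t) * G x + t * G y"

lemma edge_altitude_less_iff:
  fixes g h :: real
  assumes "g < h"
  shows "(1 - a) * g + a * h < (1 - r) * g + r * h \<longleftrightarrow> a < r"
proof -
  have "(1 - r) * g + r * h - ((1 - a) * g + a * h) = (r - a) * (h - g)" by (simp add: algebra_simps)
  then show ?thesis using assms by (metis diff_gt_0_iff_gt zero_less_mult_pos2 mult_pos_pos)
qed

lemma Inner_altitude_bounds:
  assumes "strict_mono_on T G" "Inner x y t \<in> road_carrier T"
  shows "G x < road_altitude G (Inner x y t)" "road_altitude G (Inner x y t) < G y"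
proof -
  have g: "G x < G y" "0 < t" "t < 1"
    using assms by (auto dest!: succs_less intro: strict_mono_onD[OF assms(1)])
  show "G x < road_altitude G (Inner x y t)" "road_altitude G (Inner x y t) < G y"
    using edge_altitude_less_iff[OF g(1), of 0 t] edge_altitude_less_iff[OF g(1), of t 1] g by auto
qed

lemma road_altitude_mono:
  assumes G: "strict_mono_on T G" and p: "p \<in> road_carrier T" and q: "q \<in> road_carrier T"
    and less: "road_less p q"
  shows "road_altitude G p < road_altitude G q"
proof -
  have le: "G a \<le> G b" if "a \<in> T" "b \<in> T" "a \<le> b" for a b
    using strict_mono_onD[OF G that(1,2)] that(3) by (auto simp: order_le_less)
  note b = Inner_altitude_bounds[OF G]
  show ?thesis
  proof (cases p; cases q)
    fix a a' assume "p = Node a" "q = Node a'"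
    then show ?thesis using strict_mono_onD[OF G] p q less by auto
  next
    fix a x y t assume "p = Node a" "q = Inner x y t"
    then show ?thesis using le[of a x] b(1)[of x y t] p q less by auto
  next
    fix a x y t assume "p = Inner x y t" "q = Node a"
    then show ?thesis using le[of y a] b(2)[of x y t] p q less by (auto dest: succs_less)
  next
    fix x y t x' y' t' assume pq: "p = Inner x y t" "q = Inner x' y' t'"
    show ?thesis
    proof (cases "y \<le> x'")
      case True
      then show ?thesis using le[of y x'] b(2)[of x y t] b(1)[of x' y' t'] p q pq by (auto dest: succs_less)
    next
      case False
      then have "G x < G y" using p pq by (auto dest!: succs_less intro: strict_mono_onD[OF G])
      then show ?thesis using edge_altitude_less_iff[of "G x" "G y" t t'] False less pq by auto
    qed
  qed
qed

text \<open>
  Below a node \<open>x\<close> with \<open>s \<le> G x\<close> take the least tree point \<open>m\<close> with \<open>s \<le> G m\<close>. If \<open>m\<close> is minimal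
  or at a limit level, then \<open>G m \<le> s\<close> because \<open>G\<close> does not jump, and \<open>m\<close> has altitude \<open>s\<close>. If \<open>m\<close>
  is a successor of \<open>z\<close>, then \<open>G z < s \<le> G m\<close>, and the value \<open>s\<close> is taken on the road from \<open>z\<close> to
  \<open>m\<close>.
\<close>

lemma road_altitude_attained:
  assumes T: "tree T" and alt: "tree_altitude T G"
    and p: "p \<in> road_carrier T" and s: "0 \<le> s" "s \<le> road_altitude G p"
  shows "\<exists>q\<in>road_carrier T. road_less\<^sup>=\<^sup>= q p \<and> road_altitude G q = s"
proof -
  note G = tree_altitudeD(1)[OF alt]
  have edge: "\<exists>t. 0 < t \<and> t \<le> 1 \<and> (1 - t) * g + t * h = s" if "g < s" "s \<le> h" for g h :: real
  proof (intro exI conjI)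
    let ?t = "(s - g) / (h - g)"
    have "?t * (h - g) = s - g" using that by auto
    moreover have "(1 - ?t) * g + ?t * h = g + ?t * (h - g)" by (simp only: algebra_simps)
    ultimately show "(1 - ?t) * g + ?t * h = s" by simp
  qed (use that in auto)
  have node: "\<exists>q\<in>road_carrier T. road_less\<^sup>=\<^sup>= q (Node x) \<and> road_altitude G q = s"
    if x: "x \<in> T" "s \<le> G x" for x
  proof -
    obtain m where m: "m \<in> T" "m \<le> x" "s \<le> G m" and low: "\<And>v. \<lbrakk>v \<in> T; v < m\<rbrakk> \<Longrightarrow> \<not> s \<le> G v"
      using tree_least[OF T x(1) x(1) order_refl, of "\<lambda>v. s \<le> G v"] x(2) by blast
    have ?thesis if "G m \<le> s"
      using that m by (intro bexI[of _ "Node m"]) (auto simp: order_le_less)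
    moreover have "G m \<le> s" if "minimal_point T m" using tree_altitudeD(4)[OF alt that] s by simp
    moreover have "G m \<le> s" if "at_limit_level T m" by (rule tree_altitudeD(5)[OF alt that]) (use low in force)
    moreover have ?thesis if z: "z \<in> T" "m \<in> succs T z" and ms: "\<not> G m \<le> s" for z
    proof -
      have "z < m" "G z < s" using low[OF z(1)] succs_less[OF z(2)] by auto
      then obtain t where t: "0 < t" "t \<le> 1" "(1 - t) * G z + t * G m = s"
        using edge m(3) by blast
      then have "t < 1" using ms by (cases "t = 1") auto
      then show ?thesis using t z m by (intro bexI[of _ "Inner z m t"]) auto
    qed
    ultimately show ?thesis using tree_point_cases[OF T m(1)] by metis
  qed
  show ?thesis
  proof (cases p)
    case (Node x)
    then show ?thesis using node p s by simp
  next
    case (Inner x y t)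
    then have xy: "x \<in> T" "y \<in> succs T x" "0 < t" "t < 1" using p by auto
    show ?thesis
    proof (cases "s \<le> G x")
      case True
      then obtain q where q: "q \<in> road_carrier T" "road_less\<^sup>=\<^sup>= q (Node x)" "road_altitude G q = s"
        using node xy by blast
      then have "road_less q p"
        using road_less_trans[of "Node x" T q p] xy Inner by auto
      then show ?thesis using q by blast
    next
      case False
      have g: "G x < G y" using xy by (auto dest!: succs_less intro: strict_mono_onD[OF G])
      have "s \<le> G y" using Inner_altitude_bounds(2)[OF G, of x y t] p s Inner by auto
      then obtain r where r: "0 < r" "r \<le> 1" "(1 - r) * G x + r * G y = s"
        using edge[of "G x" "G y"] False by auto
      then have "r \<le> t" using edge_altitude_less_iff[OF g, of t r] s Inner by auto
      then show ?thesis using r xy Inner by (intro bexI[of _ "Inner x y r"]) auto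
    qed
  qed
qed

section \<open>Order and topology of the road space\<close>

lemma nhd_basis_InnerI:
  assumes "open A" "A \<subseteq> {0<..<1}" "t \<in> A"
  shows "edge_part x y A \<in> nhd_basis T (Inner x y t)"
  using assms by auto

lemma W_above:
  assumes "n \<ge> 1" "q \<in> W T x n"
  shows "road_less\<^sup>=\<^sup>= (Node x) q"
  using assms by (cases q) auto

text \<open>The sets \<open>W T x n\<close> branch upwards only, so that one can leave them downwards only through
  \<open>x\<close>.\<close>

lemma W_downward:
  assumes n: "n \<ge> 1" and q: "q \<in> W T x n" and p: "p \<in> road_carrier T" "road_less\<^sup>=\<^sup>= p q"
  shows "p \<in> W T x n \<or> road_less p (Node x)"
proof (cases q)
  case (Node y)
  then show ?thesis using assms by auto
next
  case (Inner y v t)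
  then have y: "y = x" "v \<in> succs T x" "t < 1 / real n" using q n by auto
  show ?thesis
  proof (cases p)
    case (Node a)
    then show ?thesis using p Inner y n by (auto simp: order_le_less)
  next
    case (Inner a b r)
    then show ?thesis using p \<open>q = Inner y v t\<close> y n by auto
  qed
qed

text \<open>
  At a node \<open>p\<close> above \<open>q\<close>, everything in \<open>W\<close> is at or above \<open>p\<close> and hence above \<open>q\<close>; only the
  part of a neighborhood below \<open>p\<close> matters. If \<open>p\<close> is a successor node, either all of the road into \<open>p\<close>
  is above \<open>q\<close>, or \<open>q\<close> lies on it and a short end piece avoids \<open>q\<close>. At a limit level there is a
  tree point \<open>z\<close> with \<open>q \<le> z < p\<close>, and it bounds a neighborhood of \<open>p\<close>.
\<close>

lemma openin_road_above:
  assumes T: "tree T" and q: "q \<in> road_carrier T"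
  shows "openin (road_space T) {p \<in> road_carrier T. road_less q p}"
  unfolding openin_road_space[OF T] road_open_def
proof (intro conjI ballI)
  let ?U = "{p \<in> road_carrier T. road_less q p}"
  show "?U \<subseteq> road_carrier T" by blast
  fix p assume "p \<in> ?U"
  then have p: "p \<in> road_carrier T" "road_less q p" by auto
  have up: "r \<in> ?U" if "p' \<in> ?U" "r \<in> road_carrier T" "road_less\<^sup>=\<^sup>= p' r" for p' r
    using that road_less_trans[of p' T q r] by auto
  show "\<exists>N\<in>nhd_basis T p. N \<subseteq> ?U"
  proof (cases p)
    case (Inner x y t)
    show ?thesis
    proof (cases "\<exists>t'. q = Inner x y t'")
      case True
      then obtain t' where q': "q = Inner x y t'" by blast
      then have "t' < t" using p Inner by (auto dest!: succs_less)
      then show ?thesis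
        unfolding Inner using p q q' Inner by (intro Inner_nhd[of t' _ 1]) auto
    next
      case False
      then have "Inner x y s \<in> ?U" if "0 < s" "s < 1" for s
        using p Inner that by (cases q) auto
      then show ?thesis
        unfolding Inner using p Inner by (intro Inner_nhd[of 0 _ 1]) auto
    qed
  next
    case (Node x)
    then have xT: "x \<in> T" using p by simp
    have W: "W T x n \<subseteq> ?U" if "n \<ge> 1" for n
    proof
      fix r assume "r \<in> W T x n"
      then show "r \<in> ?U"
        using up[OF \<open>p \<in> ?U\<close>, of r] W_above[OF that, of r T x] W_subset_carrier[OF xT that] Node by auto
    qed
    from tree_point_cases[OF T xT] show ?thesis
    proof cases
      case 1
      show ?thesis
        unfolding Node
      proof (rule bexI)
        show "W T x 1 \<subseteq> ?U" by (rule W) simp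
        show "W T x 1 \<in> nhd_basis T (Node x)" by (rule nhd_basis_minimalI[OF 1]) simp
      qed
    next
      case (2 z)
      have "\<exists>n\<ge>1. \<forall>t. 1 - 1 / real n < t \<and> 0 < t \<and> t < 1 \<longrightarrow> road_less q (Inner z x t)"
      proof (cases q)
        case q: (Node a)
        then have "a < x" "a \<in> T" using p Node assms(2) by auto
        then have "a \<le> z" using succs_le_or_le[OF T, of x z a x] 2 xT by (auto simp: less_le_not_le)
        then show ?thesis using q by auto
      next
        case q: (Inner u v r)
        then have uv: "v \<le> x" "u \<in> T" "v \<in> succs T u" "v \<in> T" "r < 1"
          using p Node assms(2) by (auto dest: succs_less)
        show ?thesis
        proof (cases "v = x")
          case True
          then have "u = z" using succs_unique_pred[OF T] 2 uv by blast
          obtain n where n: "n \<noteq> 0" "inverse (real n) < 1 - r" using real_arch_inverse[of "1 - r"] uv(5) by auto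
          show ?thesis
            using n q True \<open>u = z\<close> by (intro exI[of _ n]) (auto simp: inverse_eq_divide)
        next
          case False
          then have "v \<le> z" using succs_le_or_le[OF T, of x z v x] 2 xT uv by (auto simp: less_le_not_le)
          then show ?thesis using q by auto
        qed
      qed
      then obtain n where n: "n \<ge> 1" "\<And>t. \<lbrakk>1 - 1 / real n < t; 0 < t; t < 1\<rbrakk> \<Longrightarrow> road_less q (Inner z x t)"
        by blast
      have "edge_part z x {1 - 1 / real n<..1} \<subseteq> ?U"
      proof
        fix r assume r: "r \<in> edge_part z x {1 - 1 / real n<..1}"
        show "r \<in> ?U"
        proof (cases r)
          case (Node v)
          then show ?thesis using r n(1) \<open>p \<in> ?U\<close> \<open>p = Node x\<close> by (auto dest: unit_bounds)
        next
          case (Inner a b t)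
          then show ?thesis using r n 2 unit_bounds(2)[of n t] by auto
        qed
      qed
      then have "W T x n \<union> edge_part z x {1 - 1 / real n<..1} \<subseteq> ?U" using W[OF n(1)] by blast
      then show ?thesis unfolding Node by (rule bexI[OF _ nhd_basis_succI[OF 2 n(1)]])
    next
      case 3
      obtain z where z: "z \<in> T" "z < x" "road_less\<^sup>=\<^sup>= q (Node z)"
      proof (cases q)
        case (Node a)
        then show ?thesis using that[of a] p q \<open>p = Node x\<close> by auto
      next
        case (Inner u v r)
        then have uv: "v \<le> x" "u \<in> T" "v \<in> succs T u" "v \<in> T"
          using p q Node by (auto dest: succs_less)
        then have "v \<noteq> x" using succs_not_limit[OF T] 3 by blast
        then show ?thesis using that[of v] uv Inner by auto
      qed
      have less: "r \<in> ?U" if "r \<in> road_carrier T" "road_less (Node z) r" for r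
        using z that road_less_trans[of "Node z" T q r] by auto
      have "{p \<in> road_carrier T. road_less (Node z) p \<and> road_less p (Node x)}
          \<union> (\<Union>w\<in>{w \<in> T. z < w \<and> w \<le> x}. W T w 1) \<subseteq> ?U"
      proof -
        have "W T w 1 \<subseteq> ?U" if w: "w \<in> T" "z < w" for w
        proof
          fix r assume "r \<in> W T w 1"
          then show "r \<in> ?U"
            using up[OF less[of "Node w"], of r] w W_above[of 1 r T w] W_subset_carrier[OF w(1), of 1] by auto
        qed
        then show ?thesis using less by blast
      qed
      then show ?thesis unfolding Node by (rule bexI[OF _ nhd_basis_limitI[OF 3 z(1,2) order_refl]])
    qed
  qed
qed

text \<open>A path from \<open>p\<close> to a larger point starts on a single road, and every neighborhood of \<open>p\<close>
  contains an initial piece of it.\<close>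

lemma road_approach:
  assumes T: "tree T" and U: "openin (road_space T) U" "p \<in> U"
    and q: "q \<in> road_carrier T" "road_less p q"
  shows "\<exists>r\<in>U. road_less p r \<and> road_less\<^sup>=\<^sup>= r q"
proof -
  have open_U: "U \<subseteq> road_carrier T" "\<exists>N\<in>nhd_basis T p. N \<subseteq> U"
    using U unfolding openin_road_space[OF T] road_open_def by blast+
  then have p: "p \<in> road_carrier T" using U by blast
  obtain N where N: "N \<in> nhd_basis T p" "N \<subseteq> U" using open_U(2) by blast
  show ?thesis
  proof (cases p)
    case (Inner x y t)
    then obtain A where A: "N = edge_part x y A" "open A" "A \<subseteq> {0<..<1}" "t \<in> A" using N by auto
    obtain e where e: "e > 0" "\<And>s. dist s t < e \<Longrightarrow> s \<in> A" using A(2,4) by (auto simp: open_dist)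
    obtain r where r: "t < r" "r < t + e" "Inner x y r = q \<or> road_less (Inner x y r) q"
    proof (cases "\<exists>t'. q = Inner x y t' \<and> t < t'")
      case True
      then obtain t' where "q = Inner x y t'" "t < t'" by blast
      then show ?thesis using that[of "min t' (t + e / 2)"] e(1) by (auto simp: min_def)
    next
      case False
      then have "road_less (Inner x y (t + e / 2)) q" using q Inner by (cases q) auto
      then show ?thesis using that[of "t + e / 2"] e(1) by auto
    qed
    then have "r \<in> A" using e(2)[of r] by (auto simp: dist_real_def)
    then have "Inner x y r \<in> N" using A by auto
    then show ?thesis using r Inner N(2) by (intro bexI[of _ "Inner x y r"]) auto
  next
    case (Node a)
    obtain n where n: "n \<ge> 1" "W T a n \<subseteq> N"
    proof -
      have "\<exists>n\<ge>1. W T a n \<subseteq> N"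
        using N(1) unfolding Node by (auto simp: at_limit_level_def; blast)
      then show ?thesis using that by blast
    qed
    have aT: "a \<in> T" using p Node by simp
    \<comment> \<open>The road from \<open>a\<close> to \<open>y\<close> is the one leading towards \<open>q\<close>.\<close>
    obtain y r where y: "y \<in> succs T a" and r: "0 < r" "r < 1 / real n" "road_less\<^sup>=\<^sup>= (Inner a y r) q"
    proof (cases "\<exists>y t. q = Inner a y t")
      case True
      then obtain y t where "q = Inner a y t" by blast
      then show ?thesis using that[of y "min t (1 / (2 * real n))"] q n(1) by (auto simp: min_def field_simps)
    next
      case False
      obtain c where c: "c \<in> T" "a < c" "road_less\<^sup>=\<^sup>= (Node c) q"
        using q False Node by (cases q) (auto simp: order_le_less)
      obtain y where "y \<in> succs T a" "y \<le> c" using succs_exists_below[OF T aT c(1,2)] .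
      moreover then have "road_less\<^sup>=\<^sup>= (Inner a y (1 / (2 * real n))) q"
        using c(3) by (cases q) auto
      ultimately show ?thesis using that[of y "1 / (2 * real n)"] n(1) by (auto simp: field_simps)
    qed
    then have "Inner a y r \<in> W T a n" using n(1) by simp
    then have "Inner a y r \<in> U" using n(2) N(2) by blast
    then show ?thesis using r Node by (intro bexI[of _ "Inner a y r"]) auto
  qed
qed

text \<open>
  For \<open>N\<close> take a basic neighborhood of \<open>p\<close>, and for \<open>s\<close> the altitude of the point at which \<open>N\<close>
  begins: a point before \<open>p\<close> on the road that contains or enters \<open>p\<close>, or the node \<open>z\<close> if \<open>p\<close> is at a limit level. A point \<open>r\<close>
  below some \<open>q \<in> N\<close> is comparable with that bound, and by monotonicity of the altitude it lies
  above it. Minimal nodes have nothing below them, so that any \<open>s < G x\<close> serves there.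
\<close>

lemma road_convex:
  assumes T: "tree T" and G: "strict_mono_on T G"
    and U: "openin (road_space T) U" "p \<in> U"
  shows "\<exists>N s. openin (road_space T) N \<and> p \<in> N \<and> N \<subseteq> U \<and> s < road_altitude G p \<and>
    (\<forall>q\<in>N. \<forall>r\<in>road_carrier T. road_less\<^sup>=\<^sup>= r q \<longrightarrow> s < road_altitude G r \<longrightarrow> r \<in> N)"
proof -
  have open_U: "U \<subseteq> road_carrier T" "\<exists>N\<in>nhd_basis T p. N \<subseteq> U"
    using U unfolding openin_road_space[OF T] road_open_def by blast+
  then have p: "p \<in> road_carrier T" using U by blast
  have wit: ?thesis if "N \<in> nhd_basis T p" "N \<subseteq> U" "s < road_altitude G p"
    "\<And>q r. \<lbrakk>q \<in> N; r \<in> road_carrier T; road_less\<^sup>=\<^sup>= r q; s < road_altitude G r\<rbrakk> \<Longrightarrow> r \<in> N" for N s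
  proof (intro exI conjI ballI impI)
    show "openin (road_space T) N" "p \<in> N"
      using road_open_nhd_basis[OF T p that(1)] nhd_basis_mem[OF p that(1)]
      by (simp_all add: openin_road_space[OF T])
  qed (rule that; assumption)+
  obtain N where N: "N \<in> nhd_basis T p" "N \<subseteq> U" using open_U(2) by blast
  have le: "road_altitude G r \<le> G a" if "r \<in> road_carrier T" "a \<in> T" "road_less\<^sup>=\<^sup>= r (Node a)" for r a
    using road_altitude_mono[OF G that(1), of "Node a"] that by auto
  \<comment> \<open>Below \<open>x\<close>, only the end of the road from its immediate predecessor \<open>z\<close> is higher than the
    point with parameter \<open>a\<close> of that road.\<close>
  have edge: "\<exists>t. r = Inner z x t \<and> a < t"
    if z: "z \<in> T" "x \<in> succs T z" and r: "r \<in> road_carrier T" "road_less r (Node x)"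
      and a: "0 \<le> a" "(1 - a) * G z + a * G x < road_altitude G r" for a r x z
  proof -
    have x: "x \<in> T" "z < x" using succs_less z by blast+
    then have g: "G z < G x" using strict_mono_onD[OF G] z by blast
    then have "\<not> (1 - a) * G z + a * G x < (1 - 0) * G z + 0 * G x"
      using a(1) by (subst edge_altitude_less_iff) auto
    then have high: "\<not> road_less\<^sup>=\<^sup>= r (Node z)" using le[OF r(1) z(1)] a(2) by force
    show ?thesis
    proof (cases r)
      case (Node c)
      then have "c \<le> z" using succs_le_or_le[OF T z(2,1) _ x(1), of c] r by (auto simp: less_le_not_le)
      then show ?thesis using high Node by (auto simp: order_le_less)
    next
      case (Inner u v t)
      then have uv: "u \<in> T" "v \<in> succs T u" "v \<le> x" "v \<in> T" using r by (auto dest: succs_less)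
      then have "v \<le> z \<or> x \<le> v" using succs_le_or_le[OF T z(2,1) _ x(1), of v] by auto
      then have "v = x" using high Inner uv by auto
      then have "u = z" using succs_unique_pred[OF T] uv z by blast
      then show ?thesis using a(2) edge_altitude_less_iff[OF g] Inner \<open>v = x\<close> by auto
    qed
  qed
  show ?thesis
  proof (cases p)
    case (Inner x y t)
    then obtain A where A: "N = edge_part x y A" "open A" "A \<subseteq> {0<..<1}" "t \<in> A" using N by auto
    have xy: "x \<in> T" "y \<in> succs T x" using p Inner by auto
    then have g: "G x < G y" by (auto dest!: succs_less intro: strict_mono_onD[OF G])
    \<comment> \<open>The open set \<open>A\<close> need not be an interval; a symmetric interval inside it, cut at half its
      radius below \<open>t\<close>, has its lower end point \<open>a\<close> in \<open>A\<close>.\<close>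
    obtain e where e: "e > 0" "\<And>s. dist s t < e \<Longrightarrow> s \<in> A" using A(2,4) by (auto simp: open_dist)
    have eA: "{t - e<..<t + e} \<subseteq> A" using e(2) by (auto simp: dist_real_def)
    define a where "a = t - e / 2"
    have a: "0 \<le> a" "a < t" "{a<..<t + e} \<subseteq> A" "t + e \<le> 1"
    proof -
      have "a \<in> A" using eA e(1) by (auto simp: a_def)
      then show "0 \<le> a" using A(3) by auto
      show at: "a < t" and sub: "{a<..<t + e} \<subseteq> A" using eA e(1) by (auto simp: a_def)
      have "t < 1" using A(3,4) by auto
      then show "t + e \<le> 1" using subsetD[OF sub, of 1] subsetD[OF A(3), of 1] at by fastforce
    qed
    show ?thesis
    proof (rule wit[of "edge_part x y {a<..<t + e}" "(1 - a) * G x + a * G y"])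
      show "edge_part x y {a<..<t + e} \<in> nhd_basis T p"
        unfolding Inner
      proof (rule nhd_basis_InnerI)
        show "{a<..<t + e} \<subseteq> {0<..<1}" using a(1,4) by auto
        show "t \<in> {a<..<t + e}" using a(2) e(1) by simp
      qed simp
      show "edge_part x y {a<..<t + e} \<subseteq> U" using edge_part_mono[OF a(3)] N(2) unfolding A(1) by (rule subset_trans)
      show "(1 - a) * G x + a * G y < road_altitude G p"
        using edge_altitude_less_iff[OF g] a Inner by simp
      fix q r assume q: "q \<in> edge_part x y {a<..<t + e}" and r: "r \<in> road_carrier T" "road_less\<^sup>=\<^sup>= r q"
        "(1 - a) * G x + a * G y < road_altitude G r"
      obtain u where u: "q = Inner x y u" "u < t + e"
        using q a(1,4) by (cases q) auto
      have q_carrier: "q \<in> road_carrier T" using q u(1) a(1,4) xy by auto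
      have "road_less r (Node y)"
        using r(2) u(1) road_less_trans[OF q_carrier, of r "Node y"] by auto
      then obtain v where v: "r = Inner x y v" "a < v" using edge[OF xy r(1) _ a(1) r(3)] by blast
      then have "v \<le> u" using r(2) u(1) succs_less[OF xy(2)] by auto
      then show "r \<in> edge_part x y {a<..<t + e}" using v u r(1) by auto
    qed
  next
    case (Node x)
    then have xT: "x \<in> T" using p by simp
    from N(1) Node consider (min) n where "N = W T x n" "minimal_point T x" "n \<ge> 1"
      | (suc) z n where "N = W T x n \<union> edge_part z x {1 - 1 / real n<..1}" "z \<in> T" "x \<in> succs T z" "n \<ge> 1"
      | (lim) z n where "N = {p \<in> road_carrier T. road_less (Node z) p \<and> road_less p (Node x)}
        \<union> (\<Union>w\<in>{w \<in> T. z < w \<and> w \<le> x}. W T w n)" "at_limit_level T x" "z \<in> T" "z < x" "n \<ge> 1"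
      by auto
    then show ?thesis
    proof cases
      case min
      show ?thesis
      proof (rule wit[OF N, of "G x - 1"])
        show "G x - 1 < road_altitude G p" using Node by simp
        fix q r assume qr: "q \<in> N" "r \<in> road_carrier T" "road_less\<^sup>=\<^sup>= r q"
        have "\<not> road_less r (Node x)"
          using min(2) qr(2) by (cases r) (auto simp: minimal_point_def preds_def dest!: succs_less intro: order.strict_trans2)
        then show "r \<in> N" using W_downward[OF min(3), of q T x r] qr min(1) by blast
      qed
    next
      case suc
      have g: "G z < G x" using suc xT by (auto dest!: succs_less intro: strict_mono_onD[OF G])
      let ?a = "1 - 1 / real n"
      have a: "0 \<le> ?a" "?a < 1" using suc(4) by (auto simp: field_simps)
      show ?thesis
      proof (rule wit[OF N, of "(1 - ?a) * G z + ?a * G x"])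
        show "(1 - ?a) * G z + ?a * G x < road_altitude G p"
          using edge_altitude_less_iff[OF g, of ?a 1] a(2) Node by simp
        fix q r assume qr: "q \<in> N" "r \<in> road_carrier T" "road_less\<^sup>=\<^sup>= r q"
          "(1 - ?a) * G z + ?a * G x < road_altitude G r"
        have "r \<in> W T x n \<or> road_less r (Node x)"
        proof (cases "q \<in> W T x n")
          case True
          then show ?thesis using W_downward[OF suc(4)] qr by blast
        next
          case False
          then obtain t where t: "q = Inner z x t" "?a < t" "t < 1"
            using qr(1) suc(1,4) by (cases q) (auto dest: unit_bounds)
          moreover have "0 < t" using t(2) a(1) by linarith
          ultimately have "q \<in> road_carrier T" using suc(2,3) by simp
          then show ?thesis using road_less_trans[of q T r "Node x"] t(1) qr(3) by auto
        qed
        then show "r \<in> N"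
        proof
          assume "road_less r (Node x)"
          then obtain t where "r = Inner z x t" "?a < t" using edge[OF suc(2,3) qr(2) _ a(1) qr(4)] by blast
          then show "r \<in> N" using qr(2) suc(1) by auto
        qed (use suc(1) in blast)
      qed
    next
      case lim
      show ?thesis
      proof (rule wit[OF N, of "G z"])
        show "G z < road_altitude G p" using strict_mono_onD[OF G lim(3) xT lim(4)] Node by simp
        fix q r assume qr: "q \<in> N" "r \<in> road_carrier T" "road_less\<^sup>=\<^sup>= r q" "G z < road_altitude G r"
        have N_carrier: "N \<subseteq> road_carrier T"
          using road_open_nhd_basis[OF T p N(1)] by (simp add: road_open_def)
        have "road_less (Node z) q"
        proof -
          have "road_less (Node z) q" if "w \<in> T" "z < w" "q \<in> W T w n" for w
            using that W_above[OF lim(5), of q T w] road_less_trans[of "Node w" T "Node z" q] by auto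
          then show ?thesis using qr(1) lim(1) by blast
        qed
        then have "road_less (Node z) r"
          using road_chain[OF T qr(2) _ _ qr(3), of "Node z"] le[OF qr(2) lim(3)] qr(4) lim(3) N_carrier qr(1)
          by fastforce
        moreover have "r \<in> N \<or> road_less r (Node x)"
        proof (cases "\<exists>w\<in>T. z < w \<and> w \<le> x \<and> q \<in> W T w n")
          case True
          then obtain w where w: "w \<in> T" "z < w" "w \<le> x" "q \<in> W T w n" by blast
          have "road_less r (Node x)" if "road_less r (Node w)"
            using that w(3) by (cases r) auto
          then show ?thesis using W_downward[OF lim(5) w(4) qr(2,3)] w lim(1) by blast
        next
          case False
          then have "road_less q (Node x)" using qr(1) lim(1) by blast
          then show ?thesis using road_less_trans[of q T r "Node x"] N_carrier qr(1,3) by blast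
        qed
        ultimately show "r \<in> N" using qr(2) lim(1) by blast
      qed
    qed
  qed
qed

section \<open>Contractibility\<close>

theorem theorem6p1:
  fixes T :: "'a::order set"
  assumes "tree T" and "rooted T" and "R_special T"
  shows "contractible_space (road_space T)"
proof -
  obtain G where alt: "tree_altitude T G" using R_special_altitude[OF assms(1,3)] by blast
  note G = tree_altitudeD[OF alt]
  obtain b where b: "minimal_point T b" "\<forall>x. minimal_point T x \<longrightarrow> x = b"
    using assms(2) unfolding rooted_def by (elim ex1E) (rule that)
  have root: "b \<le> x" if x: "x \<in> T" for x
  proof (rule tree_least[OF assms(1) x x order_refl, of "\<lambda>_. True"])
    fix m assume m: "m \<in> T" "m \<le> x" "\<And>v. \<lbrakk>v \<in> T; v < m\<rbrakk> \<Longrightarrow> \<not> True"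
    then have "minimal_point T m" by (auto simp: minimal_point_def preds_def)
    then show "b \<le> x" using b(2) m(2) by simp
  qed simp
  have range: "0 \<le> road_altitude G x \<and> road_altitude G x \<le> 1" if "x \<in> road_carrier T" for x
  proof (cases x)
    case (Node a)
    then show ?thesis using G(2,3)[of a] by simp
  next
    case (Inner a c t)
    show ?thesis
      using Inner_altitude_bounds[OF G(1) that[unfolded Inner]] G(2)[of a] G(3)[of c]
      unfolding Inner by linarith
  qed
  have bottom: "Node b \<in> road_carrier T" "road_altitude G (Node b) = 0"
    using b(1) G(4)[OF b(1)] by (simp_all add: minimal_point_def)
  have least: "road_less\<^sup>=\<^sup>= (Node b) x" if "x \<in> road_carrier T" for x
    using root that by (cases x) (auto simp: order_le_less)
  show ?thesis
  proof (rule contractible_space_altitude[of "road_space T" road_less "road_altitude G" "Node b",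
        unfolded topspace_road_space[OF assms(1)]])
    show "road_less x z" if "y \<in> road_carrier T" "road_less x y" "road_less y z" for x y z
      using that by (rule road_less_trans)
    show "road_less x y \<or> x = y \<or> road_less y x"
      if "x \<in> road_carrier T" "y \<in> road_carrier T" "z \<in> road_carrier T" "road_less\<^sup>=\<^sup>= x z" "road_less\<^sup>=\<^sup>= y z"
      for x y z
      using that by (rule road_chain[OF assms(1)])
    show "road_altitude G x < road_altitude G y"
      if "x \<in> road_carrier T" "y \<in> road_carrier T" "road_less x y" for x y
      using that by (rule road_altitude_mono[OF G(1)])
    show "\<exists>y\<in>road_carrier T. road_less\<^sup>=\<^sup>= y x \<and> road_altitude G y = s"
      if "x \<in> road_carrier T" "0 \<le> s" "s \<le> road_altitude G x" for x s
      by (rule road_altitude_attained[OF assms(1) alt that])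
    show "openin (road_space T) {y \<in> road_carrier T. road_less x y}" if "x \<in> road_carrier T" for x
      using that by (rule openin_road_above[OF assms(1)])
    show "\<exists>N s. openin (road_space T) N \<and> x \<in> N \<and> N \<subseteq> U \<and> s < road_altitude G x \<and>
        (\<forall>y\<in>N. \<forall>z\<in>road_carrier T. road_less\<^sup>=\<^sup>= z y \<longrightarrow> s < road_altitude G z \<longrightarrow> z \<in> N)"
      if "openin (road_space T) U" "x \<in> U" for x U
      using that by (rule road_convex[OF assms(1) G(1)])
    show "\<exists>z\<in>U. road_less x z \<and> road_less\<^sup>=\<^sup>= z y"
      if "openin (road_space T) U" "x \<in> U" "y \<in> road_carrier T" "road_less x y" for x y U
      using that by (rule road_approach[OF assms(1)])
  qed (fact range bottom least)+
qed

end
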